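(* Let $W$ be an injective bilateral weighted shift, with weight sequence $(w_n)_{n \in \mathbb{Z}}$, on an infinite dimensional, separable complex Hilbert space $H$. If $r_3^+(W) < r(W)$, then $W$ is a strongly compact operator.
   Context: An injective bilateral weighted shift on $H$ is a bounded linear operator $W$ with $We_n = w_n e_{n+1}$ for all $n \in \mathbb{Z}$, where $(e_n)_{n \in \mathbb{Z}}$ is an orthonormal basis of $H$ and $(w_n)_{n \in \mathbb{Z}}$ is a bounded sequence of complex numbers with $w_n \neq 0$ for every $n$. Set $r_3^+(W) = \limsup_{n \to \infty} |w_0 w_1 \cdots w_{n-1}|^{1/n}$, and let $r(W) = \lim_{n \to \infty} \|W^n\|^{1/n}$ be the spectral radius of $W$. Let $\mathcal{B}(H)$ be the algebra of bounded linear operators on $H$. A subalgebra $\mathcal{R} \subseteq \mathcal{B}(H)$ is strongly compact if its unit ball $\{R \in \mathcal{R} : \|R\| \leq 1\}$ is precompact (i.e., has compact closure) in the strong operator topology of $\mathcal{B}(H)$. An operator $T \in \mathcal{B}(H)$ is strongly compact if the algebra with identity generated by $T$, namely $\{p(T) : p \text{ a complex polynomial}\}$, is strongly compact. *)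

theory Defs
  imports "HOL-Analysis.Analysis" "HOL-Computational_Algebra.Polynomial"
begin

text \<open>Complex inner products are linear in the first argument. The real structure inherited from
  \<^class>\<open>real_inner\<close> is the restriction of the complex one, so that the norm of \<open>x\<close> is the square
  root of \<open>cinner x x\<close>.\<close>

class complex_inner = real_inner +
  fixes scaleC :: "complex \<Rightarrow> 'a \<Rightarrow> 'a" (infixr \<open>*\<^sub>C\<close> 75)
    and cinner :: "'a \<Rightarrow> 'a \<Rightarrow> complex"
  assumes scaleC_add_right: "a *\<^sub>C (x + y) = a *\<^sub>C x + a *\<^sub>C y"
    and scaleC_add_left: "(a + b) *\<^sub>C x = a *\<^sub>C x + b *\<^sub>C x"
    and scaleC_scaleC: "a *\<^sub>C b *\<^sub>C x = (a * b) *\<^sub>C x"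
    and scaleC_of_real: "complex_of_real r *\<^sub>C x = r *\<^sub>R x"
    and cinner_commute: "cinner x y = cnj (cinner y x)"
    and cinner_add_left: "cinner (x + y) z = cinner x z + cinner y z"
    and cinner_scaleC_left: "cinner (a *\<^sub>C x) y = a * cinner x y"
    and inner_eq_Re_cinner: "inner x y = Re (cinner x y)"

class complex_hilbert = complex_inner + complete_space

global_interpretation complex_vector: vector_space "scaleC :: complex \<Rightarrow> 'a \<Rightarrow> 'a::complex_inner"
proof
  show "1 *\<^sub>C x = x" for x :: 'a
    using scaleC_of_real[of 1 x] by simp
qed (simp_all add: scaleC_add_right scaleC_add_left scaleC_scaleC)

lemma cinner_self: "cinner x x = complex_of_real ((norm x)\<^sup>2)"
  for x :: "'a::complex_inner"
proof (rule complex_eqI)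
  show "Re (cinner x x) = Re (complex_of_real ((norm x)\<^sup>2))"
    by (simp add: power2_norm_eq_inner inner_eq_Re_cinner)
  have "Im (cinner x x) = - Im (cinner x x)"
    by (subst cinner_commute) simp
  then show "Im (cinner x x) = Im (complex_of_real ((norm x)\<^sup>2))"
    by simp
qed

lemma norm_scaleC: "norm (a *\<^sub>C x) = cmod a * norm x"
  for x :: "'a::complex_inner"
proof -
  have "cinner (a *\<^sub>C x) (a *\<^sub>C x) = a * cnj (cinner (a *\<^sub>C x) x)"
    by (subst cinner_scaleC_left, subst cinner_commute) (rule refl)
  also have "\<dots> = complex_of_real ((cmod a * norm x)\<^sup>2)"
    by (simp add: cinner_scaleC_left cinner_self power_mult_distrib
        complex_norm_square[symmetric] mult.assoc[symmetric] del: of_real_power)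
  finally have "(norm (a *\<^sub>C x))\<^sup>2 = (cmod a * norm x)\<^sup>2"
    by (simp only: cinner_self of_real_eq_iff)
  then show ?thesis
    by (simp add: power2_eq_iff_nonneg)
qed

lemma bounded_linear_scaleC: "bounded_linear (\<lambda>x::'a::complex_inner. a *\<^sub>C x)"
proof (rule bounded_linear_intro)
  show "a *\<^sub>C (r *\<^sub>R x) = r *\<^sub>R (a *\<^sub>C x)" for r and x :: 'a
    by (simp add: scaleC_of_real[symmetric] scaleC_scaleC mult.commute)
  show "norm (a *\<^sub>C x) \<le> norm x * cmod a" for x :: 'a
    by (simp add: norm_scaleC mult.commute)
qed (rule scaleC_add_right)

definition infinite_dimensional :: "'a::complex_inner itself \<Rightarrow> bool" where
  "infinite_dimensional _ \<longleftrightarrow> \<not> (\<exists>B::'a set. finite B \<and> complex_vector.span B = UNIV)"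

definition orthonormal_basis :: "(int \<Rightarrow> 'a::complex_inner) \<Rightarrow> bool" where
  "orthonormal_basis e \<longleftrightarrow>
     (\<forall>m n. cinner (e m) (e n) = (if m = n then 1 else 0)) \<and>
     closure (complex_vector.span (range e)) = UNIV"

text \<open>Elements of \<^typ>\<open>'a \<Rightarrow>\<^sub>L 'a\<close> are only real linear; \<open>\<B>(H)\<close> consists of the complex linear ones.
  The operator norm is that of \<^typ>\<open>'a \<Rightarrow>\<^sub>L 'a\<close>.\<close>

definition bounded_operators :: "('a::complex_inner \<Rightarrow>\<^sub>L 'a) set" where
  "bounded_operators = {T. Vector_Spaces.linear scaleC scaleC (blinfun_apply T)}"

lift_definition op_scaleC ::
    "complex \<Rightarrow> ('a::complex_inner \<Rightarrow>\<^sub>L 'a) \<Rightarrow> ('a \<Rightarrow>\<^sub>L 'a)"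
  is "\<lambda>a T x. a *\<^sub>C T x"
  by (rule bounded_linear_compose[OF bounded_linear_scaleC])

definition op_power :: "('a::complex_inner \<Rightarrow>\<^sub>L 'a) \<Rightarrow> nat \<Rightarrow> ('a \<Rightarrow>\<^sub>L 'a)" where
  "op_power T n = ((\<lambda>S. T o\<^sub>L S) ^^ n) id_blinfun"

definition op_poly :: "complex poly \<Rightarrow> ('a::complex_inner \<Rightarrow>\<^sub>L 'a) \<Rightarrow> ('a \<Rightarrow>\<^sub>L 'a)" where
  "op_poly p T = (\<Sum>i\<le>degree p. op_scaleC (coeff p i) (op_power T i))"

definition generated_algebra :: "('a::complex_inner \<Rightarrow>\<^sub>L 'a) \<Rightarrow> ('a \<Rightarrow>\<^sub>L 'a) set" where
  "generated_algebra T = range (\<lambda>p. op_poly p T)"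

definition bounded_operators_sot :: "('a::complex_inner \<Rightarrow>\<^sub>L 'a) topology" where
  "bounded_operators_sot = subtopology strong_operator_topology bounded_operators"

definition strongly_compact_algebra :: "('a::complex_inner \<Rightarrow>\<^sub>L 'a) set \<Rightarrow> bool" where
  "strongly_compact_algebra R \<longleftrightarrow>
     compactin bounded_operators_sot (bounded_operators_sot closure_of {S \<in> R. norm S \<le> 1})"

definition strongly_compact :: "('a::complex_inner \<Rightarrow>\<^sub>L 'a) \<Rightarrow> bool" where
  "strongly_compact T \<longleftrightarrow> strongly_compact_algebra (generated_algebra T)"

definition injective_bilateral_weighted_shift ::
    "('a::complex_inner \<Rightarrow>\<^sub>L 'a) \<Rightarrow> (int \<Rightarrow> complex) \<Rightarrow> bool" where
  "injective_bilateral_weighted_shift W w \<longleftrightarrow>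
     W \<in> bounded_operators \<and> bounded (range w) \<and> (\<forall>n. w n \<noteq> 0) \<and>
     (\<exists>e. orthonormal_basis e \<and> (\<forall>n. W (e n) = w n *\<^sub>C e (n + 1)))"

definition r3_plus :: "(int \<Rightarrow> complex) \<Rightarrow> ereal" where
  "r3_plus w = limsup (\<lambda>n. ereal (root n (cmod (\<Prod>k<n. w (int k)))))"

definition spectral_radius :: "('a::complex_inner \<Rightarrow>\<^sub>L 'a) \<Rightarrow> real" where
  "spectral_radius T = lim (\<lambda>n. root n (norm (op_power T n)))"

end

theory Submission
  imports Defs
begin

text \<open>Let \<open>p(W)\<close> have norm at most \<open>1\<close>. Since \<open>coeff p k * W ^ k\<close> is a diagonal of the matrix of
  \<open>p(W)\<close>, its norm is at most \<open>1\<close>, so \<open>\<bar>coeff p k\<bar> \<le> r(W) ^ (- k)\<close>. For \<open>r\<^sub>3\<^sup>+(W) < s < r(W)\<close> the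
  norm of \<open>W ^ k e\<^sub>n\<close> is \<open>O(s ^ k)\<close> for each \<open>n\<close>. Hence the coordinates of \<open>p(W) e\<^sub>n\<close> are bounded
  by a geometric series that is independent of \<open>p\<close>, and the vectors \<open>p(W) e\<^sub>n\<close> form a relatively
  compact set. By linearity and density the same holds with any vector in place of \<open>e\<^sub>n\<close>, and
  Tychonoff's theorem gives compactness in the strong operator topology.\<close>

section \<open>Compactness in the strong operator topology\<close>

text \<open>By Tychonoff the product of the \<open>C x\<close> is compact for pointwise convergence,
  and linearity and the norm bound are pointwise closed conditions. The strong operator topology is
  that of pointwise convergence, so \<open>Blinfun\<close> carries compactness over.\<close>

lemma compact_strong_operator_topology:
  fixes C :: "'a::real_normed_vector \<Rightarrow> 'b::real_normed_vector set"
  assumes C: "\<And>x. compact (C x)"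
  shows "compactin strong_operator_topology {T :: 'a \<Rightarrow>\<^sub>L 'b. norm T \<le> r \<and> (\<forall>x. blinfun_apply T x \<in> C x)}"
\<comment> \<open>For \<open>r < 0\<close> the set is empty, whereas on the zero space the zero map
  would still lie in the set \<open>L\<close> below.\<close>
proof (cases "r \<ge> 0")
  case False
  then have "{T :: 'a \<Rightarrow>\<^sub>L 'b. norm T \<le> r \<and> (\<forall>x. blinfun_apply T x \<in> C x)} = {}"
    using norm_ge_zero order_trans by blast
  then show ?thesis by (metis compactin_empty)
next
  case True
  define L where "L = {f :: 'a \<Rightarrow> 'b. (\<forall>x y. f (x + y) = f x + f y) \<and>
    (\<forall>c x. f (c *\<^sub>R x) = c *\<^sub>R f x) \<and> (\<forall>x. norm (f x) \<le> norm x * r)}"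
  have cont: "continuous_on UNIV (\<lambda>f :: 'a \<Rightarrow> 'b. f x)" for x
    by (rule continuous_on_product_coordinates)
  have "closed L"
    unfolding L_def
    by (intro closed_Collect_conj closed_Collect_all closed_Collect_eq closed_Collect_le
        continuous_intros cont)
  moreover have "compact (PiE UNIV C)"
    using C by (simp add: compactin_PiE flip: compactin_euclidean_iff euclidean_product_topology)
  ultimately have cpt: "compact (PiE UNIV C \<inter> L)"
    by (rule compact_Int_closed[rotated])
  have L: "bounded_linear f" if "f \<in> L" for f
    using that unfolding L_def by (intro bounded_linear_intro[of f r]) auto
  have ap: "blinfun_apply (Blinfun f) = f" if "f \<in> L" for f
    using L[OF that] by (rule bounded_linear_Blinfun_apply)
  have "continuous_map (top_of_set (PiE UNIV C \<inter> L)) strong_operator_topology Blinfun"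
    unfolding continuous_on_strong_operator_topo_iff_coordinatewise
  proof
    fix x
    have "continuous_on (PiE UNIV C \<inter> L) (\<lambda>f. f x)"
      using cont by (rule continuous_on_subset) simp
    then have "continuous_on (PiE UNIV C \<inter> L) (\<lambda>f. blinfun_apply (Blinfun f) x)"
      by (rule continuous_on_eq) (simp add: ap)
    then show "continuous_map (top_of_set (PiE UNIV C \<inter> L)) euclidean
        (\<lambda>f. blinfun_apply (Blinfun f) x)"
      by simp
  qed
  then have "compactin strong_operator_topology (Blinfun ` (PiE UNIV C \<inter> L))"
    using cpt by (intro image_compactin[of "top_of_set (PiE UNIV C \<inter> L)"]) auto
  moreover have "Blinfun ` (PiE UNIV C \<inter> L) = {T :: 'a \<Rightarrow>\<^sub>L 'b. norm T \<le> r \<and> (\<forall>x. blinfun_apply T x \<in> C x)}"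
  proof (intro subset_antisym subsetI)
    fix T assume "T \<in> Blinfun ` (PiE UNIV C \<inter> L)"
    then obtain f where f: "f \<in> PiE UNIV C" "f \<in> L" "T = Blinfun f" by auto
    have "norm T \<le> r"
      using True f(2,3) by (intro norm_blinfun_bound) (auto simp: ap L_def mult.commute)
    then show "T \<in> {T. norm T \<le> r \<and> (\<forall>x. blinfun_apply T x \<in> C x)}"
      using f by (auto simp: ap)
  next
    fix T :: "'a \<Rightarrow>\<^sub>L 'b" assume T: "T \<in> {T. norm T \<le> r \<and> (\<forall>x. blinfun_apply T x \<in> C x)}"
    have "norm (T x) \<le> norm x * r" for x
      using norm_blinfun[of T x] T mult_right_mono[of "norm T" r "norm x"]
      by (simp add: mult.commute)
    then have "blinfun_apply T \<in> PiE UNIV C \<inter> L"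
      using T by (auto simp: L_def blinfun.add_right blinfun.scaleR_right)
    then show "T \<in> Blinfun ` (PiE UNIV C \<inter> L)"
      by (metis blinfun_apply_inverse imageI)
  qed
  ultimately show ?thesis by simp
qed

text \<open>Operators that differ at \<open>x\<close> are separated by evaluation at
  \<open>x\<close>. The Hausdorff property makes compact sets closed, so that closures of their
  subsets stay inside them.\<close>

lemma Hausdorff_space_strong_operator_topology:
  "Hausdorff_space (strong_operator_topology ::
    ('a::real_normed_vector \<Rightarrow>\<^sub>L 'b::real_normed_vector) topology)"
  unfolding Hausdorff_space_def
proof (intro allI impI, elim conjE)
  fix S T :: "'a \<Rightarrow>\<^sub>L 'b" assume "S \<noteq> T"
  then obtain x where "S x \<noteq> T x" by (meson blinfun_eqI)
  then obtain U V where UV: "open U" "open V" "S x \<in> U" "T x \<in> V" "U \<inter> V = {}"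
    by (meson hausdorff)
  have "openin strong_operator_topology {f :: 'a \<Rightarrow>\<^sub>L 'b. f x \<in> A}" if "open A" for A
    using strong_operator_topology_basis[of "{x}" "\<lambda>_. A" "\<lambda>x. x"] that by simp
  with UV show "\<exists>U V. openin strong_operator_topology U \<and> openin strong_operator_topology V \<and>
      S \<in> U \<and> T \<in> V \<and> disjnt U V"
    by (intro exI[of _ "{f. blinfun_apply f x \<in> U}"] exI[of _ "{f. blinfun_apply f x \<in> V}"])
      (auto simp: disjnt_def)
qed

lemma bounded_operators_iff:
  "T \<in> bounded_operators \<longleftrightarrow> (\<forall>a x. T (a *\<^sub>C x) = a *\<^sub>C T x)"
  for T :: "'a::complex_inner \<Rightarrow>\<^sub>L 'a"
  unfolding bounded_operators_def
  by (simp add: Vector_Spaces.linear_iff complex_vector.vector_space_axioms blinfun.add_right)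

text \<open>Complex homogeneity is an equation between evaluations, so it survives pointwise limits.
  This passes compactness from real linear to complex linear operators.\<close>

lemma closedin_bounded_operators:
  "closedin strong_operator_topology (bounded_operators :: ('a::complex_inner \<Rightarrow>\<^sub>L 'a) set)"
proof -
  have cont: "continuous_on UNIV (\<lambda>f :: 'a \<Rightarrow> 'a. f x)" for x
    by (rule continuous_on_product_coordinates)
  have "continuous_on UNIV (\<lambda>f :: 'a \<Rightarrow> 'a. a *\<^sub>C f x)" for a x
    by (rule bounded_linear.continuous_on[OF bounded_linear_scaleC cont])
  then have "closed {f :: 'a \<Rightarrow> 'a. \<forall>a x. f (a *\<^sub>C x) = a *\<^sub>C f x}"
    by (intro closed_Collect_all closed_Collect_eq cont)
  moreover have "continuous_map strong_operator_topology euclidean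
      (blinfun_apply :: ('a \<Rightarrow>\<^sub>L 'a) \<Rightarrow> _)"
    unfolding strong_operator_topology_def
    using continuous_map_pullback[OF continuous_map_id] by (simp add: comp_def id_def)
  ultimately have "closedin strong_operator_topology
      {T \<in> topspace strong_operator_topology.
        blinfun_apply T \<in> {f :: 'a \<Rightarrow> 'a. \<forall>a x. f (a *\<^sub>C x) = a *\<^sub>C f x}}"
    by (intro closedin_continuous_map_preimage) auto
  also have "\<dots> = bounded_operators"
    by (auto simp: bounded_operators_iff strong_operator_topology_topspace)
  finally show ?thesis .
qed

text \<open>The sets \<open>C x\<close> confine the unit ball of \<open>R\<close> to a compact set
  \<open>K\<close>. The complex linear part of \<open>K\<close> is compact, hence closed, so it also
  contains the closure of the ball.\<close>

lemma strongly_compact_algebraI: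
  fixes R :: "('a::complex_inner \<Rightarrow>\<^sub>L 'a) set"
  assumes R: "R \<subseteq> bounded_operators"
    and C: "\<And>x. \<exists>C. compact C \<and> (\<forall>S\<in>R. norm S \<le> 1 \<longrightarrow> blinfun_apply S x \<in> C)"
  shows "strongly_compact_algebra R"
proof -
  obtain C where C: "\<And>x. compact (C x)" "\<And>x S. S \<in> R \<Longrightarrow> norm S \<le> 1 \<Longrightarrow> blinfun_apply S x \<in> C x"
    using assms(2) by metis
  define K where "K = {T :: 'a \<Rightarrow>\<^sub>L 'a. norm T \<le> 1 \<and> (\<forall>x. blinfun_apply T x \<in> C x)}"
  have "compactin strong_operator_topology K"
    unfolding K_def using C(1) by (rule compact_strong_operator_topology)
  then have "compactin strong_operator_topology (bounded_operators \<inter> K)"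
    by (rule closed_Int_compactin[OF closedin_bounded_operators])
  then have cpt: "compactin bounded_operators_sot (bounded_operators \<inter> K)"
    by (simp add: bounded_operators_sot_def compactin_subtopology)
  moreover have "Hausdorff_space (bounded_operators_sot :: ('a \<Rightarrow>\<^sub>L 'a) topology)"
    unfolding bounded_operators_sot_def
    by (intro Hausdorff_space_subtopology Hausdorff_space_strong_operator_topology)
  ultimately have "closedin bounded_operators_sot (bounded_operators \<inter> K)"
    using compactin_imp_closedin by blast
  then have "bounded_operators_sot closure_of {S \<in> R. norm S \<le> 1} \<subseteq> bounded_operators \<inter> K"
    using R C(2) by (intro closure_of_minimal) (auto simp: K_def)
  with cpt show ?thesis
    unfolding strongly_compact_algebra_def by (rule closed_compactin) simp
qed

section \<open>Vectors with relatively compact orbit\<close>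

text \<open>A finite net of an approximating compact set is a coarser net of \<open>A\<close>, so
  \<open>closure A\<close> is totally bounded, and it is complete.\<close>

lemma relatively_compact_if_approximable:
  fixes A :: "'a::complete_space set"
  assumes "\<And>\<epsilon>. \<epsilon> > 0 \<Longrightarrow> \<exists>C. compact C \<and> (\<forall>a\<in>A. \<exists>c\<in>C. dist a c < \<epsilon>)"
  shows "compact (closure A)"
  unfolding compact_eq_totally_bounded
proof (intro conjI allI impI)
  show "complete (closure A)" by (simp add: complete_eq_closed)
  fix \<epsilon> :: real assume "\<epsilon> > 0"
  then have pos: "\<epsilon> / 3 > 0" by simp
  obtain C where C: "compact C" "\<forall>a\<in>A. \<exists>c\<in>C. dist a c < \<epsilon> / 3"
    using assms[OF pos] by blast
  obtain k where k: "finite k" "C \<subseteq> (\<Union>x\<in>k. ball x (\<epsilon> / 3))"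
    using C(1) pos unfolding compact_eq_totally_bounded by blast
  \<comment> \<open>One third each is spent on passing from the closure to \<open>A\<close>, from
    \<open>A\<close> to \<open>C\<close>, and from \<open>C\<close> to the net.\<close>
  have "closure A \<subseteq> (\<Union>x\<in>k. ball x \<epsilon>)"
  proof
    fix b assume "b \<in> closure A"
    then obtain a where a: "a \<in> A" "dist a b < \<epsilon> / 3"
      using pos closure_approachable by blast
    then obtain c where c: "c \<in> C" "dist a c < \<epsilon> / 3" using C by blast
    then obtain x where x: "x \<in> k" "dist x c < \<epsilon> / 3" using k by auto
    have "dist x b \<le> dist x c + dist a c + dist a b"
      using dist_triangle[of x b c] dist_triangle[of c b a] by (simp add: dist_commute)
    then have "dist x b < \<epsilon>" using a c x by linarith
    with x show "b \<in> (\<Union>x\<in>k. ball x \<epsilon>)" by auto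
  qed
  with k show "\<exists>k. finite k \<and> closure A \<subseteq> (\<Union>x\<in>k. ball x \<epsilon>)" by blast
qed

text \<open>Vectors with relatively compact orbit under \<open>R\<close> are closed under linear
  combinations and, since \<open>R\<close> is uniformly bounded, under limits. This reduces the
  question to basis vectors.\<close>

lemma relatively_compact_orbits:
  fixes R :: "('a::complex_hilbert \<Rightarrow>\<^sub>L 'a) set"
  assumes R: "\<And>S. S \<in> R \<Longrightarrow> S \<in> bounded_operators \<and> norm S \<le> 1"
    and dense: "closure (complex_vector.span E) = UNIV"
    and E: "\<And>x. x \<in> E \<Longrightarrow> \<exists>C. compact C \<and> (\<forall>S\<in>R. blinfun_apply S x \<in> C)"
  shows "\<exists>C. compact C \<and> (\<forall>S\<in>R. blinfun_apply S x \<in> C)"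
proof -
  have span: "\<exists>C. compact C \<and> (\<forall>S\<in>R. blinfun_apply S y \<in> C)" if "y \<in> complex_vector.span E" for y
    using that
  proof (induction rule: complex_vector.span_induct_alt)
    case base
    show ?case by (rule exI[of _ "{0}"]) (simp add: blinfun.zero_right)
  next
    case (step a x y)
    obtain C D where C: "compact C" "\<forall>S\<in>R. blinfun_apply S x \<in> C"
      and D: "compact D" "\<forall>S\<in>R. blinfun_apply S y \<in> D"
      using E[OF step(1)] step(2) by blast
    have "compact ((*\<^sub>C) a ` C)"
      using C(1) by (intro compact_continuous_image linear_continuous_on bounded_linear_scaleC)
    then have "compact (\<Union>u\<in>(*\<^sub>C) a ` C. \<Union>v\<in>D. {u + v})"
      using D(1) by (rule compact_sums')
    moreover have "\<forall>S\<in>R. blinfun_apply S (a *\<^sub>C x + y) \<in> (\<Union>u\<in>(*\<^sub>C) a ` C. \<Union>v\<in>D. {u + v})"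
    proof
      fix S assume S: "S \<in> R"
      then have "S (a *\<^sub>C x + y) \<in> {a *\<^sub>C S x + S y}"
        using R[OF S] by (simp add: blinfun.add_right bounded_operators_iff)
      with S show "blinfun_apply S (a *\<^sub>C x + y) \<in> (\<Union>u\<in>(*\<^sub>C) a ` C. \<Union>v\<in>D. {u + v})"
        using C(2) D(2) by (intro UN_I[of "a *\<^sub>C S x"] UN_I[of "S y"] imageI) auto
    qed
    ultimately show ?case by blast
  qed
  have "compact (closure ((\<lambda>S. blinfun_apply S x) ` R))"
  proof (rule relatively_compact_if_approximable)
    fix \<epsilon> :: real assume "\<epsilon> > 0"
    then obtain y where y: "y \<in> complex_vector.span E" "dist y x < \<epsilon>"
      using dense closure_approachable[of x "complex_vector.span E"] by auto
    obtain C where C: "compact C" "\<forall>S\<in>R. blinfun_apply S y \<in> C" using span[OF y(1)] by blast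
    \<comment> \<open>The bound \<open>norm S \<le> 1\<close> makes the approximation uniform over
      \<open>R\<close>, so the one set \<open>C\<close> serves all orbit points.\<close>
    have "dist (S x) (S y) < \<epsilon>" if "S \<in> R" for S
    proof -
      have "dist (S x) (S y) = norm (S (x - y))" by (simp add: dist_norm blinfun.diff_right)
      also have "\<dots> \<le> norm S * norm (x - y)" by (rule norm_blinfun)
      also have "\<dots> \<le> 1 * norm (x - y)" using R[OF that] by (intro mult_right_mono) auto
      finally show ?thesis using y(2) by (simp add: dist_norm norm_minus_commute)
    qed
    with C show "\<exists>C. compact C \<and> (\<forall>a\<in>(\<lambda>S. blinfun_apply S x) ` R. \<exists>c\<in>C. dist a c < \<epsilon>)"
      by (intro exI[of _ C]) auto
  qed
  then show ?thesis
    by (intro exI[of _ "closure ((\<lambda>S. blinfun_apply S x) ` R)"])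
      (auto intro: subsetD[OF closure_subset])
qed

text \<open>The set is a continuous image of a product of closed discs; the induction adds one disc
  at a time as a sum of compact sets.\<close>

lemma compact_bounded_coefficients:
  fixes v :: "nat \<Rightarrow> 'a::complex_inner"
  shows "compact {\<Sum>k<N. b k *\<^sub>C v k |b. \<forall>k<N. cmod (b k) \<le> \<beta> k}"
proof (induction N)
  case (Suc N)
  let ?S = "{\<Sum>k<N. b k *\<^sub>C v k |b. \<forall>k<N. cmod (b k) \<le> \<beta> k}"
  have "bounded_linear (\<lambda>z. z *\<^sub>C v N)"
  proof (rule bounded_linear_intro)
    show "(r *\<^sub>R z) *\<^sub>C v N = r *\<^sub>R z *\<^sub>C v N" for r z
      by (simp add: scaleR_conv_of_real scaleC_scaleC flip: scaleC_of_real)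
    show "norm (z *\<^sub>C v N) \<le> norm z * norm (v N)" for z
      by (simp add: norm_scaleC)
  qed (rule scaleC_add_left)
  then have "compact ((\<lambda>z. z *\<^sub>C v N) ` cball 0 (\<beta> N))"
    by (intro compact_continuous_image linear_continuous_on compact_cball)
  with Suc.IH have "compact (\<Union>x\<in>?S. \<Union>y\<in>(\<lambda>z. z *\<^sub>C v N) ` cball 0 (\<beta> N). {x + y})"
    by (rule compact_sums')
  moreover have "(\<Union>x\<in>?S. \<Union>y\<in>(\<lambda>z. z *\<^sub>C v N) ` cball 0 (\<beta> N). {x + y}) =
      {\<Sum>k<Suc N. b k *\<^sub>C v k |b. \<forall>k<Suc N. cmod (b k) \<le> \<beta> k}" (is "?A = ?B")
  proof (intro subset_antisym subsetI)
    fix x assume "x \<in> ?A"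
    then obtain b z where b: "\<forall>k<N. cmod (b k) \<le> \<beta> k" "cmod z \<le> \<beta> N"
      "x = (\<Sum>k<N. b k *\<^sub>C v k) + z *\<^sub>C v N" by auto
    then have "x = (\<Sum>k<Suc N. (b(N := z)) k *\<^sub>C v k)"
      by simp
    moreover have "\<forall>k<Suc N. cmod ((b(N := z)) k) \<le> \<beta> k"
      using b by (auto simp: less_Suc_eq)
    ultimately show "x \<in> ?B" by blast
  next
    fix x assume "x \<in> ?B"
    then obtain b where b: "\<forall>k<Suc N. cmod (b k) \<le> \<beta> k" "x = (\<Sum>k<Suc N. b k *\<^sub>C v k)"
      by blast
    have "(\<Sum>k<N. b k *\<^sub>C v k) \<in> ?S" using b(1) by auto
    moreover have "b N *\<^sub>C v N \<in> (\<lambda>z. z *\<^sub>C v N) ` cball 0 (\<beta> N)"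
      using b(1) by (intro imageI) simp
    moreover have "x \<in> {(\<Sum>k<N. b k *\<^sub>C v k) + b N *\<^sub>C v N}" using b(2) by simp
    ultimately show "x \<in> ?A" by (intro UN_I)
  qed
  ultimately show ?case by simp
qed auto

text \<open>Summability makes the tails small uniformly in \<open>b\<close> and \<open>d\<close>, so
  cutting all sums at one fixed \<open>N\<close> approximates the whole set by a compact
  one.\<close>

lemma relatively_compact_summable_coefficients:
  fixes v :: "nat \<Rightarrow> 'a::complex_hilbert"
  assumes v: "\<And>k. norm (v k) \<le> 1" and \<beta>: "summable \<beta>"
  shows "compact (closure {\<Sum>k<d. b k *\<^sub>C v k |b d. \<forall>k. cmod (b k) \<le> \<beta> k})"
proof (rule relatively_compact_if_approximable)
  fix \<epsilon> :: real assume "\<epsilon> > 0"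
  then obtain N where N: "\<And>m n. m \<ge> N \<Longrightarrow> norm (sum \<beta> {m..<n}) < \<epsilon>"
    using \<beta> unfolding summable_Cauchy by blast
  let ?C = "{\<Sum>k<N. b k *\<^sub>C v k |b. \<forall>k<N. cmod (b k) \<le> \<bar>\<beta> k\<bar>}"
  have "\<exists>c\<in>?C. dist (\<Sum>k<d. b k *\<^sub>C v k) c < \<epsilon>" if b: "\<forall>k. cmod (b k) \<le> \<beta> k" for b d
  proof -
    \<comment> \<open>Padding by zeros extends the sum to \<open>max d N\<close> terms, so that it
      can be cut at \<open>N\<close> even if \<open>d < N\<close>.\<close>
    define b' where "b' k = (if k < d then b k else 0)" for k
    have "(\<Sum>k<d. b k *\<^sub>C v k) = (\<Sum>k<max d N. b' k *\<^sub>C v k)"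
      by (rule sum.mono_neutral_cong_left) (auto simp: b'_def)
    also have "\<dots> = (\<Sum>k<N. b' k *\<^sub>C v k) + (\<Sum>k=N..<max d N. b' k *\<^sub>C v k)"
      by (simp add: lessThan_atLeast0 sum.atLeastLessThan_concat)
    finally have "dist (\<Sum>k<d. b k *\<^sub>C v k) (\<Sum>k<N. b' k *\<^sub>C v k) =
        norm (\<Sum>k=N..<max d N. b' k *\<^sub>C v k)"
      by (simp add: dist_norm)
    also have "\<dots> \<le> (\<Sum>k=N..<max d N. \<beta> k)"
    proof (rule sum_norm_le)
      fix k
      have "cmod (b' k) \<le> \<beta> k" using b order_trans[OF norm_ge_zero, of "b k" "\<beta> k"] by (simp add: b'_def)
      then show "norm (b' k *\<^sub>C v k) \<le> \<beta> k"
        using v[of k] mult_left_mono[OF v[of k], of "cmod (b' k)"] by (simp add: norm_scaleC)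
    qed
    also have "\<dots> < \<epsilon>" using N[of N "max d N"] by simp
    finally have "dist (\<Sum>k<d. b k *\<^sub>C v k) (\<Sum>k<N. b' k *\<^sub>C v k) < \<epsilon>" .
    moreover have "\<forall>k<N. cmod (b' k) \<le> \<bar>\<beta> k\<bar>"
      using b by (auto simp: b'_def intro: order_trans[OF _ abs_ge_self])
    ultimately show ?thesis by blast
  qed
  then show "\<exists>C. compact C \<and>
      (\<forall>a\<in>{\<Sum>k<d. b k *\<^sub>C v k |b d. \<forall>k. cmod (b k) \<le> \<beta> k}. \<exists>c\<in>C. dist a c < \<epsilon>)"
    using compact_bounded_coefficients[of v N "\<lambda>k. \<bar>\<beta> k\<bar>"] by blast
qed

section \<open>The spectral radius\<close>

text \<open>Fekete's lemma in root form. For \<open>t\<close> above the infimum, submultiplicativity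
  gives \<open>a n \<le> D * t ^ n\<close> with a constant \<open>D\<close>, whose roots tend to
  \<open>1\<close>.\<close>

lemma Fekete_submultiplicative:
  fixes a :: "nat \<Rightarrow> real"
  assumes pos: "\<And>n. a n > 0" and sub: "\<And>m n. a (m + n) \<le> a m * a n"
  shows "(\<lambda>n. root n (a n)) \<longlonglongrightarrow> (INF n\<in>{1..}. root n (a n))"
proof (rule order_tendstoI)
  let ?L = "INF n\<in>{1..}. root n (a n)"
  have bdd: "bdd_below ((\<lambda>n. root n (a n)) ` {1..})"
    using pos by (intro bdd_belowI2[of _ 0]) (simp add: less_imp_le)
  {
    fix l assume l: "l < ?L"
    have "l < root n (a n)" if "n \<ge> 1" for n
      using l cINF_lower[OF bdd, of n] that by simp
    then show "\<forall>\<^sub>F n in sequentially. l < root n (a n)"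
      unfolding eventually_sequentially by blast
  next
    fix u assume "?L < u"
    then obtain t where t: "?L < t" "t < u" using dense by blast
    then obtain N where N: "N \<ge> 1" "root N (a N) < t"
      using cINF_less_iff[OF _ bdd, of t] by auto
    have "root N (a N) > 0" using N pos[of N] by simp
    with N have t0: "t > 0" by linarith
    have aN: "a N \<le> t ^ N"
    proof -
      have "a N = root N (a N) ^ N" using N pos[of N] by simp
      also have "\<dots> \<le> t ^ N" using N \<open>root N (a N) > 0\<close> by (intro power_mono) auto
      finally show ?thesis .
    qed
    \<comment> \<open>The sum dominates the ratios with index below \<open>N\<close>, to which
      larger indices reduce by splitting off blocks of length \<open>N\<close>. The added
      \<open>1\<close> makes \<open>D\<close> positive.\<close>
    define D where "D = (\<Sum>m<N. a m / t ^ m) + 1"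
    have D: "D > 0" unfolding D_def using pos t0
      by (intro add_nonneg_pos sum_nonneg) (auto intro: less_imp_le)
    have le: "a n \<le> D * t ^ n" for n
    proof (induction n rule: less_induct)
      case (less n)
      show ?case
      proof (cases "n < N")
        case True
        have "a n / t ^ n \<le> (\<Sum>m<N. a m / t ^ m)"
          using True pos t0 by (intro member_le_sum) (auto intro: less_imp_le)
        then have "a n / t ^ n \<le> D" by (simp add: D_def)
        then show ?thesis using t0 by (simp add: field_simps)
      next
        case False
        then have n: "n = N + (n - N)" by simp
        have "a n \<le> a N * a (n - N)" using sub[of N "n - N"] n by simp
        also have "\<dots> \<le> t ^ N * (D * t ^ (n - N))"
          using aN less[of "n - N"] N False pos t0 by (intro mult_mono) (auto intro: less_imp_le)
        also have "\<dots> = D * t ^ n" by (subst (2) n) (simp add: power_add)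
        finally show ?thesis .
      qed
    qed
    have "(\<lambda>n. root n D * t) \<longlonglongrightarrow> 1 * t"
      by (intro tendsto_mult tendsto_const LIMSEQ_root_const D)
    then have "\<forall>\<^sub>F n in sequentially. root n D * t < u"
      using t by (intro order_tendstoD) auto
    then show "\<forall>\<^sub>F n in sequentially. root n (a n) < u"
      using eventually_gt_at_top[of 0]
    proof eventually_elim
      case (elim n)
      have "root n (a n) \<le> root n (D * t ^ n)" using elim le by simp
      also have "\<dots> = root n D * t"
        using elim t0 by (simp add: real_root_mult real_root_power_cancel)
      finally show ?case using elim by linarith
    qed
  }
qed

lemma op_power_0 [simp]: "op_power T 0 = id_blinfun"
  and op_power_Suc [simp]: "op_power T (Suc n) = T o\<^sub>L op_power T n"
  by (simp_all add: op_power_def)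

lemma op_power_add: "op_power T (m + n) = op_power T m o\<^sub>L op_power T n"
  by (induction m) (auto intro!: blinfun_eqI)

text \<open>By Fekete's lemma the limit exists and is an infimum, so it bounds every single root
  from below. Nonzero powers supply the positivity required there.\<close>

lemma spectral_radius_power_le_norm:
  assumes "\<And>n. op_power T n \<noteq> 0"
  shows "spectral_radius T ^ n \<le> norm (op_power T n)"
\<comment> \<open>Since \<open>root 0\<close> is constantly \<open>0\<close>, the case
  \<open>n = 0\<close> is separate: the identity has norm at least \<open>1\<close> as soon as there
  is a nonzero vector.\<close>
proof (cases "n = 0")
  case True
  have "(0::'a \<Rightarrow>\<^sub>L 'a) \<noteq> id_blinfun" using assms[of 0] by simp
  then obtain x :: 'a where "x \<noteq> 0" by (metis blinfun_eqI)
  then show ?thesis using True norm_blinfun[of "id_blinfun :: 'a \<Rightarrow>\<^sub>L 'a" x] by simp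
next
  case False
  let ?a = "\<lambda>n. norm (op_power T n)"
  have "(\<lambda>n. root n (?a n)) \<longlonglongrightarrow> (INF n\<in>{1..}. root n (?a n))"
    using assms by (intro Fekete_submultiplicative)
      (auto simp: op_power_add norm_blinfun_compose)
  then have r: "spectral_radius T = (INF n\<in>{1..}. root n (?a n))"
    unfolding spectral_radius_def by (rule limI)
  have bdd: "bdd_below ((\<lambda>n. root n (?a n)) ` {1..})"
    by (intro bdd_belowI2[of _ 0]) simp
  have "spectral_radius T \<le> root n (?a n)"
    unfolding r using bdd False by (intro cINF_lower) auto
  moreover have "spectral_radius T \<ge> 0"
    unfolding r by (intro cINF_greatest) auto
  ultimately have "spectral_radius T ^ n \<le> root n (?a n) ^ n" by (rule power_mono)
  then show ?thesis using False by simp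
qed

section \<open>Weighted shifts\<close>

lemma cinner_scaleC_right: "cinner x (a *\<^sub>C y) = cnj a * cinner x y"
  for x :: "'a::complex_inner"
proof -
  have "cinner x (a *\<^sub>C y) = cnj (cinner (a *\<^sub>C y) x)" by (rule cinner_commute)
  also have "\<dots> = cnj a * cnj (cinner y x)" by (simp add: cinner_scaleC_left)
  also have "cnj (cinner y x) = cinner x y" by (rule cinner_commute[symmetric])
  finally show ?thesis .
qed

lemma norm_orthonormal_basis:
  assumes "orthonormal_basis e"
  shows "norm (e n) = 1"
proof -
  have "(norm (e n))\<^sup>2 = Re (cinner (e n) (e n))"
    by (simp add: power2_norm_eq_inner inner_eq_Re_cinner)
  also have "\<dots> = 1" using assms by (simp add: orthonormal_basis_def)
  finally show ?thesis by (metis norm_ge_zero power2_eq_iff_nonneg power_one zero_le_one)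
qed

text \<open>Pythagoras, with a reindexing \<open>f\<close> so that it covers both the shifted
  vectors \<open>e (i + int k)\<close> and the column of \<open>p(W)\<close> that starts at
  \<open>e n\<close>.\<close>

lemma norm_sum_orthonormal_basis:
  assumes e: "orthonormal_basis e" and I: "finite I" "inj_on f I"
  shows "(norm (\<Sum>i\<in>I. c i *\<^sub>C e (f i)))\<^sup>2 = (\<Sum>i\<in>I. (cmod (c i))\<^sup>2)"
proof -
  have "pairwise (\<lambda>i j. orthogonal (c i *\<^sub>C e (f i)) (c j *\<^sub>C e (f j))) I"
    using e I(2) by (auto simp: pairwise_def orthogonal_def inner_eq_Re_cinner
        cinner_scaleC_left cinner_scaleC_right orthonormal_basis_def inj_on_eq_iff)
  then show ?thesis
    using I(1) by (simp add: norm_sum_Pythagorean norm_scaleC norm_orthonormal_basis[OF e])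
qed

text \<open>The coefficient of \<open>e (n + int k)\<close> in the image of \<open>e n\<close> under
  the \<open>k\<close>-th power of the shift; for \<open>n = 0\<close> it is the product in
  \<open>r3_plus\<close>.\<close>

definition weight_prod :: "(int \<Rightarrow> complex) \<Rightarrow> int \<Rightarrow> nat \<Rightarrow> complex" where
  "weight_prod w n k = (\<Prod>j<k. w (n + int j))"

lemma weight_prod_Suc: "weight_prod w n (Suc k) = w (n + int k) * weight_prod w n k"
  by (simp add: weight_prod_def)

lemma weight_prod_Suc_shift: "weight_prod w n (Suc k) = w n * weight_prod w (n + 1) k"
  unfolding weight_prod_def by (subst prod.lessThan_Suc_shift) (simp add: add.assoc)

lemma op_power_bounded_operators:
  assumes "W \<in> bounded_operators"
  shows "op_power W k \<in> bounded_operators"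
  using assms by (induction k) (simp_all add: bounded_operators_iff)

lemma op_poly_apply: "op_poly p W x = (\<Sum>i\<le>degree p. coeff p i *\<^sub>C op_power W i x)"
  by (simp add: op_poly_def blinfun.sum_left op_scaleC.rep_eq)

lemma op_poly_bounded_operators:
  assumes "W \<in> bounded_operators"
  shows "op_poly p W \<in> bounded_operators"
  using op_power_bounded_operators[OF assms]
  by (simp add: bounded_operators_iff op_poly_apply complex_vector.scale_sum_right
      scaleC_scaleC mult.commute)

lemma op_power_shift:
  assumes W: "W \<in> bounded_operators" "\<And>n. blinfun_apply W (e n) = w n *\<^sub>C e (n + 1)"
  shows "op_power W k (e n) = weight_prod w n k *\<^sub>C e (n + int k)"
proof (induction k)
  case (Suc k)
  have "op_power W (Suc k) (e n) = weight_prod w n k *\<^sub>C W (e (n + int k))"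
    using Suc W(1) by (simp add: bounded_operators_iff)
  then show ?case
    by (simp add: W(2) scaleC_scaleC weight_prod_Suc ac_simps)
qed (simp add: weight_prod_def)

text \<open>The power sends distinct basis vectors to multiples of distinct basis vectors, so
  Pythagoras bounds it on the span, and density does the rest.\<close>

lemma norm_op_power_shift_le:
  assumes e: "orthonormal_basis e"
    and W: "W \<in> bounded_operators" "\<And>n. blinfun_apply W (e n) = w n *\<^sub>C e (n + 1)"
    and D: "\<And>n. cmod (weight_prod w n k) \<le> D"
  shows "norm (op_power W k) \<le> D"
proof (rule norm_blinfun_bound)
  show "0 \<le> D" using D[of 0] norm_ge_zero order_trans by blast
  let ?T = "op_power W k"
  have "norm (?T x) \<le> D * norm x" if x: "x \<in> complex_vector.span (range e)" for x
  proof -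
    obtain t r where t: "finite t" "t \<subseteq> range e" "x = (\<Sum>a\<in>t. r a *\<^sub>C a)"
      using x unfolding complex_vector.span_explicit by blast
    then obtain I where I: "inj_on e I" "t = e ` I"
      unfolding subset_image_inj by blast
    have fin: "finite I" using I t(1) finite_imageD by blast
    define c where "c = r \<circ> e"
    have x: "x = (\<Sum>i\<in>I. c i *\<^sub>C e i)"
      using t(3) I by (simp add: sum.reindex c_def)
    have "?T x = (\<Sum>i\<in>I. (c i * weight_prod w i k) *\<^sub>C e (i + int k))"
      using op_power_bounded_operators[OF W(1), of k] op_power_shift[where e = e and w = w, OF W]
      by (simp add: x blinfun.sum_right bounded_operators_iff scaleC_scaleC)
    then have "(norm (?T x))\<^sup>2 = (\<Sum>i\<in>I. (cmod (c i * weight_prod w i k))\<^sup>2)"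
      using norm_sum_orthonormal_basis[OF e fin, of "\<lambda>i. i + int k" "\<lambda>i. c i * weight_prod w i k"]
      by (simp add: inj_on_def)
    also have "\<dots> \<le> (\<Sum>i\<in>I. (cmod (c i) * D)\<^sup>2)"
      by (intro sum_mono power_mono) (auto simp: norm_mult intro: mult_left_mono D)
    also have "\<dots> = (D * norm x)\<^sup>2"
      using norm_sum_orthonormal_basis[OF e fin inj_on_id, of c]
      by (simp add: x power_mult_distrib sum_distrib_left mult.commute)
    finally show ?thesis
      by (rule power2_le_imp_le) (simp add: \<open>0 \<le> D\<close>)
  qed
  moreover have "closed {x. norm (?T x) \<le> D * norm x}"
    by (intro closed_Collect_le continuous_intros)
  ultimately have "closure (complex_vector.span (range e)) \<subseteq> {x. norm (?T x) \<le> D * norm x}"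
    by (intro closure_minimal) auto
  then show "norm (?T x) \<le> D * norm x" for x
    using e by (auto simp: orthonormal_basis_def)
qed

text \<open>In the basis \<open>e\<close>, the operator \<open>coeff p k * W ^ k\<close> is the \<open>k\<close>-th diagonal of \<open>p(W)\<close>, and the
  norm of a diagonal is its largest entry.\<close>

lemma norm_coeff_op_power_shift_le:
  assumes e: "orthonormal_basis e"
    and W: "W \<in> bounded_operators" "\<And>n. blinfun_apply W (e n) = w n *\<^sub>C e (n + 1)"
  shows "cmod (coeff p k) * norm (op_power W k) \<le> norm (op_poly p W)"
proof (cases "coeff p k = 0")
  case False
  then have k: "k \<le> degree p" by (rule le_degree)
  have "cmod (coeff p k) * cmod (weight_prod w n k) \<le> norm (op_poly p W)" for n
  proof -
    let ?c = "\<lambda>i. coeff p i * weight_prod w n i"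
    \<comment> \<open>The \<open>?c i\<close> are the entries of column \<open>n\<close> of
      \<open>p(W)\<close>; one entry is at most the norm of its column.\<close>
    have "(cmod (?c k))\<^sup>2 \<le> (\<Sum>i\<le>degree p. (cmod (?c i))\<^sup>2)"
      using k by (intro member_le_sum) auto
    also have "\<dots> = (norm (\<Sum>i\<le>degree p. ?c i *\<^sub>C e (n + int i)))\<^sup>2"
      using e by (subst norm_sum_orthonormal_basis) (auto simp: inj_on_def)
    also have "(\<Sum>i\<le>degree p. ?c i *\<^sub>C e (n + int i)) = op_poly p W (e n)"
      by (simp add: op_poly_apply op_power_shift[where e = e and w = w, OF W] scaleC_scaleC)
    finally have "cmod (?c k) \<le> norm (op_poly p W (e n))"
      by (rule power2_le_imp_le) simp
    also have "\<dots> \<le> norm (op_poly p W)"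
      using norm_blinfun[of "op_poly p W" "e n"] by (simp add: norm_orthonormal_basis[OF e])
    finally show ?thesis by (simp add: norm_mult)
  qed
  then have "norm (op_power W k) \<le> norm (op_poly p W) / cmod (coeff p k)"
    using False by (intro norm_op_power_shift_le[OF e W]) (simp add: field_simps)
  then show ?thesis using False by (simp add: field_simps)
qed simp

text \<open>Only products starting at index \<open>0\<close> enter \<open>r3_plus\<close>. Moving
  the start by one changes the length by one and the product by a nonzero weight, which the constant
  absorbs.\<close>

lemma weight_prod_geometric_bound:
  assumes w: "\<And>n. w n \<noteq> 0" and s: "r3_plus w < ereal s"
  shows "s > 0" and "\<exists>C. \<forall>k. cmod (weight_prod w n k) \<le> C * s ^ k"
proof -
  have "\<forall>\<^sub>F k in sequentially. ereal (root k (cmod (\<Prod>j<k. w (int j)))) < ereal s"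
    using s unfolding r3_plus_def by (rule Limsup_lessD)
  then obtain N where N: "\<And>k. k \<ge> N \<Longrightarrow> root k (cmod (weight_prod w 0 k)) < s"
    unfolding eventually_sequentially by (auto simp: weight_prod_def)
  have "0 \<le> root N (cmod (weight_prod w 0 N))" by (cases "N = 0") simp_all
  also have "\<dots> < s" using N by simp
  finally show s0: "s > 0" .
  show "\<exists>C. \<forall>k. cmod (weight_prod w n k) \<le> C * s ^ k"
  proof (induction n rule: int_induct[where k = 0])
    case base
    \<comment> \<open>The sum covers the lengths up to \<open>N\<close>; the \<open>1\<close> covers
      the longer products, which are at most \<open>s ^ k\<close>.\<close>
    define C where "C = (\<Sum>k\<le>N. cmod (weight_prod w 0 k) / s ^ k) + 1"
    have "cmod (weight_prod w 0 k) \<le> C * s ^ k" for k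
    proof (cases "k \<le> N")
      case True
      have "cmod (weight_prod w 0 k) / s ^ k \<le> (\<Sum>k\<le>N. cmod (weight_prod w 0 k) / s ^ k)"
        using True s0 by (intro member_le_sum) (auto intro: less_imp_le)
      then have "cmod (weight_prod w 0 k) / s ^ k \<le> C" by (simp add: C_def)
      then show ?thesis using s0 by (simp add: field_simps)
    next
      case False
      have "cmod (weight_prod w 0 k) = root k (cmod (weight_prod w 0 k)) ^ k"
        using False by simp
      also have "\<dots> \<le> s ^ k"
        using N[of k] False by (intro power_mono) auto
      also have "\<dots> \<le> C * s ^ k"
        using s0 by (simp add: C_def distrib_right sum_nonneg)
      finally show ?thesis .
    qed
    then show ?case by blast
  next
    case (step1 i)
    then obtain C where C: "\<And>k. cmod (weight_prod w i k) \<le> C * s ^ k" by blast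
    have "cmod (weight_prod w (i + 1) k) \<le> (C * s / cmod (w i)) * s ^ k" for k
      using C[of "Suc k"] w[of i] by (simp add: weight_prod_Suc_shift norm_mult field_simps)
    then show ?case by blast
  next
    case (step2 i)
    then obtain C where C: "\<And>k. cmod (weight_prod w i k) \<le> C * s ^ k" by blast
    have C0: "C \<ge> 1" using C[of 0] by (simp add: weight_prod_def)
    \<comment> \<open>The added \<open>1\<close> handles the empty product at \<open>k = 0\<close>,
      which has no first factor to split off.\<close>
    have "cmod (weight_prod w (i - 1) k) \<le> (cmod (w (i - 1)) * C / s + 1) * s ^ k" for k
    proof (cases k)
      case 0
      then show ?thesis using s0 C0 by (simp add: weight_prod_def)
    next
      case (Suc l)
      have "cmod (weight_prod w (i - 1) k) = cmod (w (i - 1)) * cmod (weight_prod w i l)"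
        by (simp add: Suc weight_prod_Suc_shift norm_mult)
      also have "\<dots> \<le> cmod (w (i - 1)) * (C * s ^ l)"
        by (intro mult_left_mono C) simp
      also have "\<dots> = (cmod (w (i - 1)) * C / s) * s ^ k"
        using s0 by (simp add: Suc)
      also have "\<dots> \<le> (cmod (w (i - 1)) * C / s + 1) * s ^ k"
        using s0 by (intro mult_right_mono) auto
      finally show ?thesis .
    qed
    then show ?case by blast
  qed
qed

theorem theorem2:
  fixes W :: "'a::complex_hilbert \<Rightarrow>\<^sub>L 'a"
    and w :: "int \<Rightarrow> complex"
  assumes "infinite_dimensional TYPE('a)"
    and "separable_space (euclidean :: 'a topology)"
    and "injective_bilateral_weighted_shift W w"
    and "r3_plus w < ereal (spectral_radius W)"
  shows "strongly_compact W"
proof -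
  obtain e where e: "orthonormal_basis e"
    and W: "W \<in> bounded_operators" "\<And>n. blinfun_apply W (e n) = w n *\<^sub>C e (n + 1)"
    and w: "\<And>n. w n \<noteq> 0"
    using assms(3) unfolding injective_bilateral_weighted_shift_def by blast
  \<comment> \<open>The power maps \<open>e 0\<close> to a nonzero multiple of a basis
    vector.\<close>
  have "op_power W k \<noteq> 0" for k
  proof
    assume "op_power W k = 0"
    then have "norm (weight_prod w 0 k *\<^sub>C e (0 + int k)) = 0"
      using op_power_shift[where e = e and w = w, OF W, of k 0] by simp
    then show False
      using w by (simp add: norm_scaleC norm_orthonormal_basis[OF e] weight_prod_def)
  qed
  then have r: "spectral_radius W ^ k \<le> norm (op_power W k)" for k
    by (rule spectral_radius_power_le_norm)
  obtain s where s: "r3_plus w < ereal s" "s < spectral_radius W"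
    using ereal_dense2[OF assms(4)] by auto
  note s0 = weight_prod_geometric_bound(1)[OF w s(1)]
  \<comment> \<open>The ratio of the geometric series: coefficients decay like powers of
    \<open>1 / spectral_radius W\<close>, while weight products grow at most like powers of
    \<open>s\<close>.\<close>
  define q where "q = s / spectral_radius W"
  have q: "0 < q" "q < 1" using s0 s(2) by (auto simp: q_def)
  let ?B = "{S \<in> generated_algebra W. norm S \<le> 1}"
  have basis: "\<exists>C. compact C \<and> (\<forall>S\<in>?B. blinfun_apply S (e n) \<in> C)" for n
  proof -
    obtain C where C: "\<And>k. cmod (weight_prod w n k) \<le> C * s ^ k"
      using weight_prod_geometric_bound(2)[OF w s(1)] by blast
    \<comment> \<open>The length \<open>d\<close> is left free because the degrees of the
      polynomials are unbounded; the bound on the coefficients does not depend on the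
      polynomial.\<close>
    let ?A = "{\<Sum>k<d. b k *\<^sub>C e (n + int k) |b d. \<forall>k. cmod (b k) \<le> C * q ^ k}"
    have "summable (\<lambda>k. C * q ^ k)"
      using q by (intro summable_mult summable_geometric) simp
    then have "compact (closure ?A)"
      by (intro relatively_compact_summable_coefficients)
        (simp_all add: norm_orthonormal_basis[OF e])
    moreover have "S (e n) \<in> ?A" if S: "S \<in> ?B" for S
    proof -
      obtain p where p: "S = op_poly p W" using S by (auto simp: generated_algebra_def)
      have "cmod (coeff p k * weight_prod w n k) \<le> C * q ^ k" for k
      proof -
        have "cmod (coeff p k) * spectral_radius W ^ k \<le> cmod (coeff p k) * norm (op_power W k)"
          by (intro mult_left_mono r) simp
        also have "\<dots> \<le> 1"
          using norm_coeff_op_power_shift_le[OF e W, of p k] S p by simp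
        finally have "cmod (coeff p k) \<le> 1 / spectral_radius W ^ k"
          using s0 s(2) by (simp add: field_simps)
        then have "cmod (coeff p k) * cmod (weight_prod w n k) \<le>
            1 / spectral_radius W ^ k * (C * s ^ k)"
          using s0 s(2) by (intro mult_mono C) auto
        then show ?thesis by (simp add: norm_mult q_def power_divide mult.commute)
      qed
      moreover have "S (e n) = (\<Sum>k<Suc (degree p). (coeff p k * weight_prod w n k) *\<^sub>C e (n + int k))"
        by (simp add: p op_poly_apply op_power_shift[where e = e and w = w, OF W] scaleC_scaleC
            lessThan_Suc_atMost del: sum.lessThan_Suc)
      ultimately show ?thesis
        unfolding mem_Collect_eq
        by (intro exI[of _ "\<lambda>k. coeff p k * weight_prod w n k"] exI[of _ "Suc (degree p)"]
            conjI allI)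
    qed
    ultimately show ?thesis
      by (intro exI[of _ "closure ?A"] conjI ballI subsetD[OF closure_subset])
  qed
  show ?thesis
    unfolding strongly_compact_def
  proof (rule strongly_compact_algebraI)
    show alg: "generated_algebra W \<subseteq> bounded_operators"
      using op_poly_bounded_operators[OF W(1)] by (auto simp: generated_algebra_def)
    fix x
    have "\<exists>C. compact C \<and> (\<forall>S\<in>?B. blinfun_apply S x \<in> C)"
    proof (rule relatively_compact_orbits)
      show "closure (complex_vector.span (range e)) = UNIV"
        using e by (simp add: orthonormal_basis_def)
      show "\<exists>C. compact C \<and> (\<forall>S\<in>?B. blinfun_apply S y \<in> C)" if "y \<in> range e" for y
        using that basis by (elim imageE) (simp only:)
    qed (use alg in auto)
    then show "\<exists>C. compact C \<and>
        (\<forall>S\<in>generated_algebra W. norm S \<le> 1 \<longrightarrow> blinfun_apply S x \<in> C)"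
      by blast
  qed
qed

end
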